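(* Every simple purely infinite C*-algebra is of type III.
   Context: A simple C*-algebra $A$ is purely infinite if every nonzero hereditary C*-subalgebra of $A$ contains an infinite projection (a projection Murray–von Neumann equivalent to a proper subprojection of itself). For $S\subseteq B$ in a C*-algebra $B$, $\mathrm{Ann}_B(S)=\{a\in B: as+sa=0\ \forall s\in S\}$, and $\mathcal{P}_B=\{\mathrm{Ann}_B(\mathrm{Ann}_B(S)): S\subseteq B_+\}$ is the lattice of annihilators of $B$ (ordered by inclusion). Each $V\in\mathcal{P}_A$ is a C*-subalgebra; $V$ is modular if $\mathcal{P}_V$ (annihilators computed inside $V$) is a modular lattice. $\mathcal{P}_A$ is purely nonmodular if there is no nonzero modular annihilator in $\mathcal{P}_A$. $A$ is of type III if $\mathcal{P}_A$ is purely nonmodular. *)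

theory Defs
  imports "HOL-Analysis.Analysis"
begin

class cstar_algebra = banach + real_normed_algebra +
  fixes cscale :: "complex \<Rightarrow> 'a \<Rightarrow> 'a"
    and adj :: "'a \<Rightarrow> 'a"
  assumes cscale_of_real: "cscale (complex_of_real r) x = scaleR r x"
    and cscale_add_right: "cscale c (x + y) = cscale c x + cscale c y"
    and cscale_add_left: "cscale (c + d) x = cscale c x + cscale d x"
    and cscale_cscale: "cscale c (cscale d x) = cscale (c * d) x"
    and norm_cscale: "norm (cscale c x) = cmod c * norm x"
    and cscale_mult_left: "cscale c x * y = cscale c (x * y)"
    and cscale_mult_right: "x * cscale c y = cscale c (x * y)"
    and adj_adj: "adj (adj x) = x"
    and adj_add: "adj (x + y) = adj x + adj y"
    and adj_mult: "adj (x * y) = adj y * adj x"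
    and adj_cscale: "adj (cscale c x) = cscale (cnj c) (adj x)"
    and cstar_identity: "norm (adj x * x) = norm x * norm x"

definition pos_in :: "'a::cstar_algebra set \<Rightarrow> 'a set" where
  "pos_in B = {adj b * b | b. b \<in> B}"

definition positive :: "'a::cstar_algebra \<Rightarrow> bool" where
  "positive a \<longleftrightarrow> a \<in> pos_in UNIV"

definition is_projection :: "'a::cstar_algebra \<Rightarrow> bool" where
  "is_projection p \<longleftrightarrow> p * p = p \<and> adj p = p"

definition mvn_equiv :: "'a::cstar_algebra \<Rightarrow> 'a \<Rightarrow> bool" where
  "mvn_equiv p q \<longleftrightarrow> (\<exists>v. adj v * v = p \<and> v * adj v = q)"

definition infinite_projection :: "'a::cstar_algebra \<Rightarrow> bool" where
  "infinite_projection p \<longleftrightarrow> is_projection p \<and>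
     (\<exists>q. is_projection q \<and> q * p = q \<and> q \<noteq> p \<and> mvn_equiv p q)"

definition cstar_subalgebra :: "'a::cstar_algebra set \<Rightarrow> bool" where
  "cstar_subalgebra B \<longleftrightarrow> closed B \<and> 0 \<in> B \<and>
     (\<forall>x\<in>B. \<forall>y\<in>B. x + y \<in> B \<and> x * y \<in> B) \<and>
     (\<forall>c. \<forall>x\<in>B. cscale c x \<in> B) \<and> (\<forall>x\<in>B. adj x \<in> B)"

definition hereditary :: "'a::cstar_algebra set \<Rightarrow> bool" where
  "hereditary B \<longleftrightarrow> cstar_subalgebra B \<and>
     (\<forall>a b. b \<in> B \<longrightarrow> positive a \<longrightarrow> positive (b - a) \<longrightarrow> a \<in> B)"

definition closed_ideal :: "'a::cstar_algebra set \<Rightarrow> bool" where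
  "closed_ideal I \<longleftrightarrow> closed I \<and> 0 \<in> I \<and> (\<forall>x\<in>I. \<forall>y\<in>I. x + y \<in> I) \<and>
     (\<forall>c. \<forall>x\<in>I. cscale c x \<in> I) \<and> (\<forall>x\<in>I. \<forall>a. a * x \<in> I \<and> x * a \<in> I)"

definition simple_cstar :: "'a::cstar_algebra itself \<Rightarrow> bool" where
  "simple_cstar _ \<longleftrightarrow> (UNIV::'a set) \<noteq> {0} \<and>
     (\<forall>I::'a set. closed_ideal I \<longrightarrow> I = {0} \<or> I = UNIV)"

definition purely_infinite :: "'a::cstar_algebra itself \<Rightarrow> bool" where
  "purely_infinite _ \<longleftrightarrow> (\<forall>B::'a set. hereditary B \<and> B \<noteq> {0} \<longrightarrow>
     (\<exists>p\<in>B. infinite_projection p))"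

definition Ann :: "'a::cstar_algebra set \<Rightarrow> 'a set \<Rightarrow> 'a set" where
  "Ann B S = {a \<in> B. \<forall>s\<in>S. a * s + s * a = 0}"

definition Plattice :: "'a::cstar_algebra set \<Rightarrow> 'a set set" where
  "Plattice B = {Ann B (Ann B S) | S. S \<subseteq> pos_in B}"

definition is_sup_in :: "'b set set \<Rightarrow> 'b set \<Rightarrow> 'b set \<Rightarrow> 'b set \<Rightarrow> bool" where
  "is_sup_in L x y s \<longleftrightarrow> s \<in> L \<and> x \<subseteq> s \<and> y \<subseteq> s \<and> (\<forall>u\<in>L. x \<subseteq> u \<and> y \<subseteq> u \<longrightarrow> s \<subseteq> u)"

definition is_inf_in :: "'b set set \<Rightarrow> 'b set \<Rightarrow> 'b set \<Rightarrow> 'b set \<Rightarrow> bool" where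
  "is_inf_in L x y i \<longleftrightarrow> i \<in> L \<and> i \<subseteq> x \<and> i \<subseteq> y \<and> (\<forall>u\<in>L. u \<subseteq> x \<and> u \<subseteq> y \<longrightarrow> u \<subseteq> i)"

definition modular_lattice :: "'b set set \<Rightarrow> bool" where
  "modular_lattice L \<longleftrightarrow>
     (\<forall>x\<in>L. \<forall>y\<in>L. (\<exists>s. is_sup_in L x y s) \<and> (\<exists>i. is_inf_in L x y i)) \<and>
     (\<forall>x y z m l j r. x \<in> L \<longrightarrow> y \<in> L \<longrightarrow> z \<in> L \<longrightarrow> x \<subseteq> z \<longrightarrow>
        is_inf_in L y z m \<longrightarrow> is_sup_in L x m l \<longrightarrow>
        is_sup_in L x y j \<longrightarrow> is_inf_in L j z r \<longrightarrow> l = r)"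

definition modular_annihilator :: "'a::cstar_algebra set \<Rightarrow> bool" where
  "modular_annihilator V \<longleftrightarrow> modular_lattice (Plattice V)"

definition purely_nonmodular :: "'a::cstar_algebra itself \<Rightarrow> bool" where
  "purely_nonmodular _ \<longleftrightarrow>
     (\<forall>V \<in> Plattice (UNIV::'a set). modular_annihilator V \<longrightarrow> V = {0})"

definition type_III :: "'a::cstar_algebra itself \<Rightarrow> bool" where
  "type_III T \<longleftrightarrow> purely_nonmodular T"

end

theory Submission
  imports Defs
begin

text \<open>A nonzero annihilator \<open>V\<close> is a hereditary subalgebra, so it contains an infinite projection \<open>p\<close>,
  say \<open>v\<^sup>* v = p\<close> and \<open>v v\<^sup>* = q < p\<close>. The elements \<open>v\<^sup>n (p - q)\<close> behave like an infinite orthonormal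
  sequence of vectors; split it into \<open>\<epsilon>\<^sub>n\<close> and \<open>\<phi>\<^sub>n\<close>. As for closed subspaces of a Hilbert space,
  the annihilators \<open>z\<close> of all \<open>\<phi>\<^sub>n\<close>, \<open>x\<close> of all \<open>\<phi>\<^sub>n\<close> and \<open>\<Sum> 2\<^sup>-\<^sup>n \<epsilon>\<^sub>n\<close>, and \<open>y\<close> of all
  \<open>\<phi>\<^sub>n - 4\<^sup>-\<^sup>n \<epsilon>\<^sub>n\<close> violate the modular law: \<open>x\<close> is strictly below \<open>z\<close>, the meet of \<open>y\<close> and \<open>z\<close> lies
  below \<open>x\<close>, and the join of \<open>x\<close> and \<open>y\<close> is \<open>V\<close>.

  That annihilators are hereditary and two-sided rests on the positivity of \<open>x\<^sup>* x\<close>, obtained here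
  without unitization and spectral theory from norm estimates for \<open>x \<mapsto> t x - h x\<close>.\<close>

section \<open>Elementary facts on C*-algebras\<close>

lemma adj_zero [simp]: "adj (0::'a::cstar_algebra) = 0"
  using adj_add[of "0::'a" 0] by simp

lemma adj_minus [simp]: "adj (- x) = - adj (x::'a::cstar_algebra)"
  using adj_add[of x "- x"] by (simp add: eq_neg_iff_add_eq_0 add.commute)

lemma adj_diff: "adj (x - y) = adj x - adj (y::'a::cstar_algebra)"
  using adj_add[of x "- y"] by simp

lemma adj_scaleR: "adj (r *\<^sub>R x) = r *\<^sub>R adj (x::'a::cstar_algebra)"
  using adj_cscale[of "complex_of_real r" x] by (simp add: cscale_of_real)

lemma cscale_one [simp]: "cscale 1 x = (x::'a::cstar_algebra)"
  using cscale_of_real[of 1 x] by simp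

lemma cscale_minus_left [simp]: "cscale (- c) x = - cscale c (x::'a::cstar_algebra)"
proof -
  have "cscale 0 x = 0" using cscale_of_real[of 0 x] by simp
  then show ?thesis using cscale_add_left[of c "- c" x] by (simp add: minus_unique)
qed

lemma norm_mult_adj: "norm (x * adj x) = norm x * norm (x::'a::cstar_algebra)"
  and norm_adj [simp]: "norm (adj x) = norm x"
proof -
  have le: "norm y \<le> norm (adj y)" for y :: 'a
  proof (cases "y = 0")
    case False
    have "norm y * norm y \<le> norm (adj y) * norm y"
      using norm_mult_ineq[of "adj y" y] by (simp add: cstar_identity)
    with False show ?thesis by simp
  qed simp
  show eq: "norm (adj x) = norm x"
    using le[of x] le[of "adj x"] by (simp add: adj_adj)
  show "norm (x * adj x) = norm x * norm x"
    using cstar_identity[of "adj x"] by (simp add: adj_adj eq)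
qed

lemma adj_mult_eq_0_iff [simp]: "adj x * x = 0 \<longleftrightarrow> (x::'a::cstar_algebra) = 0"
  using cstar_identity[of x] by auto

lemma mult_adj_eq_0_iff [simp]: "x * adj x = 0 \<longleftrightarrow> (x::'a::cstar_algebra) = 0"
  using norm_mult_adj[of x] by auto

lemma bounded_linear_adj: "bounded_linear (adj :: 'a::cstar_algebra \<Rightarrow> 'a)"
  by (rule bounded_linear_intro[of _ 1]) (simp_all add: adj_add adj_scaleR)

lemma cscale_minus_right [simp]: "cscale c (- x) = - cscale c (x::'a::cstar_algebra)"
  by (metis cscale_cscale cscale_minus_left cscale_one mult.commute)

lemma cscale_diff_right: "cscale c (x - y) = cscale c x - cscale c (y::'a::cstar_algebra)"
  using cscale_add_right[of c x "- y"] by simp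

text \<open>The cross terms cancel once \<open>adj u * w\<close> is self-adjoint; this detects
  norm-preserving combinations in the absence of a unit.\<close>

lemma adj_mult_add_cscale_i:
  fixes u w :: "'a::cstar_algebra"
  shows "adj (u + cscale \<i> w) * (u + cscale \<i> w)
    = adj u * u + cscale \<i> (adj u * w) - cscale \<i> (adj w * u) + adj w * w"
  by (simp add: adj_add adj_cscale algebra_simps cscale_diff_right
      cscale_mult_left cscale_mult_right cscale_cscale)

text \<open>Testing on \<open>adj g\<close> recovers the norm of \<open>g\<close> from left
  multiplication, so estimates made in the formal unitization descend to the algebra.\<close>

lemma norm_le_if_mult_bound:
  fixes g :: "'a::cstar_algebra"
  assumes "\<And>x::'a. norm (g * x) \<le> K * norm x" and "K \<ge> 0"
  shows "norm g \<le> K"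
proof (cases "g = 0")
  case True
  then show ?thesis using assms(2) by simp
next
  case False
  have "norm g * norm g \<le> K * norm g"
    using assms(1)[of "adj g"] by (simp add: norm_mult_adj)
  with False show ?thesis by simp
qed

section \<open>Square roots\<close>

text \<open>Writing \<open>W x = \<lambda> x - k x\<close> and \<open>T\<^sub>n x = \<lambda> r\<^sub>n x - f\<^sub>n x\<close>, this is the iteration
  \<open>T\<^sub>n\<^sub>+\<^sub>1 = (W + T\<^sub>n\<^sup>2) / 2\<close> in the unitization. The same scalar iteration \<open>r\<close> started with
  \<open>W = 1\<close> dominates it, also at the boundary case of norm 1.\<close>

lemma quadratic_fixpoint:
  fixes k :: "'a::cstar_algebra"
  assumes sa: "adj k = k" and l: "l = (0::real) \<or> l = 1"
    and bd: "\<And>x. norm (l *\<^sub>R x - k * x) \<le> norm x"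
  shows "\<exists>c. adj c = c \<and> (\<forall>x. norm (l *\<^sub>R x - c * x) \<le> norm x) \<and>
    2 *\<^sub>R c = k + (2 * l) *\<^sub>R c - c * c \<and> (\<forall>y. k * y = y * k \<longrightarrow> c * y = y * c)"
proof -
  define r :: "nat \<Rightarrow> real" where "r = rec_nat 0 (\<lambda>_ s. (1 + s\<^sup>2) / 2)"
  have r0: "r 0 = 0" and rS: "r (Suc n) = (1 + (r n)\<^sup>2) / 2" for n
    by (simp_all add: r_def)
  define f :: "nat \<Rightarrow> 'a" where
    "f = rec_nat 0 (\<lambda>n g. (1/2) *\<^sub>R (k + (2 * l * r n) *\<^sub>R g - g * g))"
  have f0: "f 0 = 0" and fS: "f (Suc n) = (1/2) *\<^sub>R (k + (2 * l * r n) *\<^sub>R f n - f n * f n)" for n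
    by (simp_all add: f_def)
  define T where "T n x = (l * r n) *\<^sub>R x - f n * x" for n x
  have T0: "T 0 x = 0" for x by (simp add: T_def r0 f0)
  \<comment> \<open>This is where \<open>l * l = l\<close> matters: squaring keeps the scalar part
    of the form \<open>l\<close> times the scalar iterate.\<close>
  have lS: "l * r (Suc n) = l / 2 + (l * r n) * (l * r n) / 2" for n
    using l by (auto simp: rS power2_eq_square field_simps)
  have TS: "T (Suc n) x = (1/2) *\<^sub>R (l *\<^sub>R x - k * x) + (1/2) *\<^sub>R T n (T n x)" for n x
  proof -
    have half: "(1/2) *\<^sub>R (s *\<^sub>R y) + (1/2) *\<^sub>R (s *\<^sub>R y) = s *\<^sub>R y" for s and y :: 'a
      by (simp flip: scaleR_add_left)
    show ?thesis
      unfolding T_def lS fS using half[of "l * r n" "f n * x"] by (simp add: algebra_simps)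
  qed
  have Tdiff: "T n (x - y) = T n x - T n y" for n x y
    by (simp add: T_def algebra_simps)
  have r_nn: "0 \<le> r n" for n by (cases n) (simp_all add: r0 rS)
  have r_mono: "r n \<le> r (Suc n)" for n
    using sum_power2_ge_zero[of "r n - 1" 0] by (simp add: rS power2_eq_square algebra_simps)
  have Tbd: "norm (T n x) \<le> r n * norm x" for n x
  proof (induction n arbitrary: x)
    case 0
    then show ?case by (simp add: T0 r0)
  next
    case (Suc n)
    have "norm (T n (T n x)) \<le> r n * norm (T n x)" by (rule Suc)
    also have "\<dots> \<le> r n * (r n * norm x)" by (intro mult_left_mono Suc r_nn)
    finally have a: "norm (T n (T n x)) \<le> r n * (r n * norm x)" .
    have "norm (T (Suc n) x) \<le> norm ((1/2) *\<^sub>R (l *\<^sub>R x - k * x)) + norm ((1/2) *\<^sub>R T n (T n x))"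
      unfolding TS by (rule norm_triangle_ineq)
    also have "\<dots> \<le> (1/2) * norm x + (1/2) * (r n * (r n * norm x))"
      using a bd[of x] by simp
    also have "\<dots> = r (Suc n) * norm x" by (simp add: rS power2_eq_square algebra_simps)
    finally show ?case .
  qed
  have inc: "norm (T (Suc n) x - T n x) \<le> (r (Suc n) - r n) * norm x" for n x
  proof (induction n arbitrary: x)
    case 0
    then show ?case using bd[of x] unfolding TS by (simp add: T0 r0 rS T_def f0)
  next
    case (Suc n)
    \<comment> \<open>A^2 - B^2 = A (A - B) + (A - B) B needs no commutation, and the scalar
      iterates obey the same identity.\<close>
    have "T (Suc (Suc n)) x - T (Suc n) x
        = (1/2) *\<^sub>R (T (Suc n) (T (Suc n) x - T n x) + (T (Suc n) (T n x) - T n (T n x)))"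
      unfolding TS[of "Suc n" x] TS[of n x] Tdiff
      unfolding TS[of n x, symmetric] by (simp add: algebra_simps TS)
    then have "norm (T (Suc (Suc n)) x - T (Suc n) x)
       \<le> (1/2) * (norm (T (Suc n) (T (Suc n) x - T n x)) + norm (T (Suc n) (T n x) - T n (T n x)))"
      using norm_triangle_ineq by simp
    also have "\<dots> \<le> (1/2) * (r (Suc n) * ((r (Suc n) - r n) * norm x)
         + (r (Suc n) - r n) * (r n * norm x))"
    proof (intro mult_left_mono add_mono)
      show "norm (T (Suc n) (T (Suc n) x - T n x)) \<le> r (Suc n) * ((r (Suc n) - r n) * norm x)"
        by (rule order_trans[OF Tbd]) (intro mult_left_mono Suc r_nn)
      show "norm (T (Suc n) (T n x) - T n (T n x)) \<le> (r (Suc n) - r n) * (r n * norm x)"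
        by (rule order_trans[OF Suc]) (use r_mono[of n] in \<open>auto intro!: mult_left_mono Tbd\<close>)
    qed simp
    also have "\<dots> = (r (Suc (Suc n)) - r (Suc n)) * norm x"
      by (simp add: rS[of "Suc n"] rS[of n] power2_eq_square field_simps)
    finally show ?case .
  qed
  have r_le1: "r n \<le> 1" for n
  proof (induction n)
    case (Suc n)
    then have "(r n)\<^sup>2 \<le> 1" using r_nn[of n] by (simp add: power_le_one)
    then show ?case by (simp add: rS)
  qed (simp add: r0)
  have "incseq r" by (rule incseq_SucI) (rule r_mono)
  then obtain R where R: "r \<longlonglongrightarrow> R" using incseq_convergent[of r 1] r_le1 by blast
  have "(\<lambda>n. r (Suc n)) \<longlonglongrightarrow> (1 + R\<^sup>2) / 2" unfolding rS by (intro tendsto_intros R) simp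
  with LIMSEQ_Suc[OF R] have "R = (1 + R\<^sup>2) / 2" by (rule LIMSEQ_unique)
  \<comment> \<open>The scalar fixpoint equation has 1 as a double root, which determines the
    limit.\<close>
  then have "(R - 1)\<^sup>2 = 0" by (simp add: power2_eq_square algebra_simps)
  then have R1: "r \<longlonglongrightarrow> 1" using R by simp
  \<comment> \<open>The factor 2 accounts for the scalar part and for the increment of
    \<open>T\<close>; the bounds telescope, so the increments of \<open>f\<close> are
    summable.\<close>
  have finc: "norm (f (Suc n) - f n) \<le> 2 * (r (Suc n) - r n)" for n
  proof (rule norm_le_if_mult_bound)
    fix x
    have "(f (Suc n) - f n) * x = (l * (r (Suc n) - r n)) *\<^sub>R x - (T (Suc n) x - T n x)"
      by (simp add: T_def algebra_simps)
    then have "norm ((f (Suc n) - f n) * x)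
        \<le> norm ((l * (r (Suc n) - r n)) *\<^sub>R x) + norm (T (Suc n) x - T n x)"
      by (simp only: norm_triangle_ineq4)
    also have "norm ((l * (r (Suc n) - r n)) *\<^sub>R x) \<le> (r (Suc n) - r n) * norm x"
      using l r_mono[of n] by auto
    finally show "norm ((f (Suc n) - f n) * x) \<le> 2 * (r (Suc n) - r n) * norm x"
      using inc[of n x] by (simp add: algebra_simps)
  qed (use r_mono[of n] in simp)
  have "summable (\<lambda>n. 2 * (r (Suc n) - r n))"
    by (intro summable_mult) (rule telescope_summable[OF R])
  then have "summable (\<lambda>n. f (Suc n) - f n)"
    by (rule summable_comparison_test'[where N=0]) (rule finc)
  then have "(\<lambda>n. \<Sum>i<n. f (Suc i) - f i) \<longlonglongrightarrow> (\<Sum>n. f (Suc n) - f n)"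
    by (rule summable_LIMSEQ)
  then obtain c where c: "f \<longlonglongrightarrow> c" by (simp add: sum_lessThan_telescope f0)
  have "adj (f n) = f n" for n
    by (induction n) (simp_all add: f0 fS adj_scaleR adj_add adj_diff adj_mult sa)
  moreover have "(\<lambda>n. adj (f n)) \<longlonglongrightarrow> adj c"
    by (rule bounded_linear.tendsto[OF bounded_linear_adj c])
  ultimately have 1: "adj c = c" using c LIMSEQ_unique by auto
  have 2: "norm (l *\<^sub>R x - c * x) \<le> norm x" for x
  proof (rule LIMSEQ_le)
    have "(\<lambda>n. norm (T n x)) \<longlonglongrightarrow> norm ((l * 1) *\<^sub>R x - c * x)"
      unfolding T_def by (intro tendsto_intros R1 c)
    then show "(\<lambda>n. norm (T n x)) \<longlonglongrightarrow> norm (l *\<^sub>R x - c * x)" by simp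
    have "(\<lambda>n. r n * norm x) \<longlonglongrightarrow> 1 * norm x" by (intro tendsto_intros R1)
    then show "(\<lambda>n. r n * norm x) \<longlonglongrightarrow> norm x" by simp
  qed (use Tbd in blast)
  have "(\<lambda>n. f (Suc n)) \<longlonglongrightarrow> (1/2) *\<^sub>R (k + (2 * l * 1) *\<^sub>R c - c * c)"
    unfolding fS by (intro tendsto_intros R1 c)
  with LIMSEQ_Suc[OF c] have "c = (1/2) *\<^sub>R (k + (2 * l * 1) *\<^sub>R c - c * c)"
    by (rule LIMSEQ_unique)
  then have "2 *\<^sub>R c = 2 *\<^sub>R ((1/2) *\<^sub>R (k + (2 * l * 1) *\<^sub>R c - c * c))" by (rule arg_cong)
  then have 3: "2 *\<^sub>R c = k + (2 * l) *\<^sub>R c - c * c" by simp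
  have 4: "c * y = y * c" if y: "k * y = y * k" for y
  proof -
    have "f n * y = y * f n" for n
    proof (induction n)
      case (Suc n)
      have "f n * f n * y = y * (f n * f n)" by (metis Suc mult.assoc)
      then show ?case using Suc y by (simp add: fS algebra_simps)
    qed (simp add: f0)
    moreover have "(\<lambda>n. f n * y) \<longlonglongrightarrow> c * y" "(\<lambda>n. y * f n) \<longlonglongrightarrow> y * c"
      by (intro tendsto_intros c)+
    ultimately show ?thesis using LIMSEQ_unique by auto
  qed
  show ?thesis using 1 2 3 4 by blast
qed

text \<open>For \<open>l = 0\<close> and \<open>k = - (a * a)\<close> the fixpoint \<open>c\<close>
  satisfies (1 + c)^2 = 1 - a^2 in the unitization, so it suffices that 1 + c is a
  contraction.\<close>

lemma sa_square_bound:
  fixes a :: "'a::cstar_algebra"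
  assumes sa: "adj a = a" and le: "norm a \<le> 1"
  shows "norm (x - a * a * x) \<le> norm x"
proof -
  have bd: "norm (0 *\<^sub>R x - - (a * a) * x) \<le> norm x" for x
  proof -
    have "norm (a * y) \<le> norm y" for y
      using norm_mult_ineq[of a y] mult_right_mono[OF le, of "norm y"] by simp
    from this[of "a * x"] this[of x] show ?thesis by (simp add: mult.assoc)
  qed
  have sak: "adj (- (a * a)) = - (a * a)" by (simp add: sa adj_mult)
  obtain c where c: "adj c = c"
    and c2: "2 *\<^sub>R c = - (a * a) + (2 * 0) *\<^sub>R c - c * c"
    and comm: "\<forall>y. - (a * a) * y = y * - (a * a) \<longrightarrow> c * y = y * c"
    using quadratic_fixpoint[OF sak disjI1[OF refl] bd] by blast
  have ca: "c * a = a * c" using comm by (simp add: mult.assoc)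
  have cc: "c * c = - (a * a) - 2 *\<^sub>R c" using c2 by (simp add: algebra_simps)
  \<comment> \<open>\<open>\<plusminus> a + i (1 + c)\<close> is unitary because \<open>(1 + c)\<^sup>2 = 1 - a\<^sup>2\<close>; hence \<open>1 + c\<close> is a contraction.\<close>
  have iso: "norm (b * y + cscale \<i> (y + c * y)) = norm y"
    if b: "adj b = b" "b * b = a * a" "c * b = b * c" for b y
  proof -
    let ?w = "y + c * y"
    have "adj (b * y + cscale \<i> ?w) * (b * y + cscale \<i> ?w)
      = adj y * b * (b * y) + cscale \<i> (adj y * b * ?w) - cscale \<i> (adj ?w * (b * y)) + adj ?w * ?w"
      by (simp only: adj_mult_add_cscale_i adj_mult[of b] b(1))
    \<comment> \<open>Since \<open>b\<close> and \<open>c\<close> commute, the two cross terms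
      coincide and cancel.\<close>
    also have "adj y * b * ?w = adj ?w * (b * y)"
      using b(3) by (simp add: adj_add adj_mult c algebra_simps) (metis mult.assoc)
    also have "adj ?w * ?w = adj y * y + 2 *\<^sub>R (adj y * (c * y)) + adj y * ((c * c) * y)"
      by (simp add: adj_add adj_mult c algebra_simps scaleR_2)
    also have "\<dots> = adj y * y - adj y * (a * a * y)"
      unfolding cc by (simp add: algebra_simps)
    also have "adj y * b * (b * y) = adj y * (a * a * y)"
      unfolding b(2)[symmetric] by (simp add: mult.assoc)
    finally have "adj (b * y + cscale \<i> ?w) * (b * y + cscale \<i> ?w) = adj y * y" by simp
    then show ?thesis using cstar_identity[of "b * y + cscale \<i> ?w"] cstar_identity[of y]
      by (metis norm_ge_zero abs_of_nonneg real_sqrt_abs2)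
  qed
  have contr: "norm (y + c * y) \<le> norm y" for y
  proof -
    let ?w = "cscale \<i> (y + c * y)"
    have "2 *\<^sub>R ?w = (a * y + ?w) + (- a * y + ?w)" by (simp add: scaleR_2)
    then have "norm (2 *\<^sub>R ?w) \<le> norm (a * y + ?w) + norm (- a * y + ?w)"
      using norm_triangle_ineq by metis
    also have "norm (a * y + ?w) = norm y" by (rule iso) (simp_all add: sa ca)
    also have "norm (- a * y + ?w) = norm y" by (rule iso) (simp_all add: sa ca)
    finally show ?thesis by (simp add: norm_cscale)
  qed
  have "c * (c * x) = - (a * a * x) - 2 *\<^sub>R (c * x)"
    unfolding mult.assoc[of c c x, symmetric] cc by (simp add: left_diff_distrib)
  then have "x - a * a * x = (x + c * x) + c * (x + c * x)"
    by (simp add: distrib_left scaleR_2)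
  then show ?thesis using order_trans[OF contr[of "x + c * x"] contr[of x]] by (simp only:)
qed

text \<open>For \<open>l = 1\<close> the linear terms of the fixpoint equation cancel and leave
  \<open>c * c = k\<close>. The commutation clause stands in for functional calculus.\<close>

lemma sa_sqrt:
  fixes k :: "'a::cstar_algebra"
  assumes "adj k = k" and "\<And>x. norm (x - k * x) \<le> norm x"
  shows "\<exists>c. adj c = c \<and> c * c = k \<and> (\<forall>x. norm (x - c * x) \<le> norm x) \<and>
    (\<forall>y. k * y = y * k \<longrightarrow> c * y = y * c)"
proof -
  have bd: "norm (1 *\<^sub>R x - k * x) \<le> norm x" for x using assms(2) by simp
  show ?thesis
    using quadratic_fixpoint[OF assms(1) disjI2[OF refl] bd] by auto
qed

section \<open>The positive cone\<close>

text \<open>In the unitization this says \<open>\<parallel>t - h\<parallel> \<le> t\<close>, which for self-adjoint \<open>h\<close> means that the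
  spectrum is nonnegative.\<close>

definition norm_positive :: "'a::cstar_algebra \<Rightarrow> bool" where
  "norm_positive h \<longleftrightarrow> (\<exists>t\<ge>0. \<forall>x. norm (t *\<^sub>R x - h * x) \<le> t * norm x)"

lemma norm_positive_add:
  assumes "norm_positive h" "norm_positive k"
  shows "norm_positive (h + k)"
proof -
  obtain t s where ts: "t \<ge> 0" "\<forall>x. norm (t *\<^sub>R x - h * x) \<le> t * norm x"
    "s \<ge> 0" "\<forall>x. norm (s *\<^sub>R x - k * x) \<le> s * norm x"
    using assms unfolding norm_positive_def by blast
  have "norm ((t + s) *\<^sub>R x - (h + k) * x) \<le> (t + s) * norm x" for x
  proof -
    have "(t + s) *\<^sub>R x - (h + k) * x = (t *\<^sub>R x - h * x) + (s *\<^sub>R x - k * x)"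
      by (simp add: algebra_simps)
    then have "norm ((t + s) *\<^sub>R x - (h + k) * x) \<le> norm (t *\<^sub>R x - h * x) + norm (s *\<^sub>R x - k * x)"
      using norm_triangle_ineq by metis
    then show ?thesis using ts(2,4) by (smt (verit) distrib_right)
  qed
  then show ?thesis unfolding norm_positive_def using ts(1,3) by (intro exI[of _ "t + s"]) auto
qed

lemma norm_positive_scaleR:
  assumes "norm_positive h" "c \<ge> 0"
  shows "norm_positive (c *\<^sub>R h)"
proof -
  obtain t where t: "t \<ge> 0" "\<And>x. norm (t *\<^sub>R x - h * x) \<le> t * norm x"
    using assms unfolding norm_positive_def by blast
  have "norm ((c * t) *\<^sub>R x - (c *\<^sub>R h) * x) \<le> (c * t) * norm x" for x
  proof -
    have "(c * t) *\<^sub>R x - (c *\<^sub>R h) * x = c *\<^sub>R (t *\<^sub>R x - h * x)" by (simp add: algebra_simps)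
    then show ?thesis using t(2)[of x] assms(2) by (simp add: mult_left_mono mult.assoc)
  qed
  then show ?thesis unfolding norm_positive_def using t(1) assms(2) by (intro exI[of _ "c * t"]) auto
qed

lemma norm_positive_scaleR_iff: "c > 0 \<Longrightarrow> norm_positive (c *\<^sub>R h) \<longleftrightarrow> norm_positive h"
  using norm_positive_scaleR[of h c] norm_positive_scaleR[of "c *\<^sub>R h" "inverse c"] by auto

lemma norm_positive_square:
  assumes "adj a = a"
  shows "norm_positive (a * a)"
proof -
  define b where "b = (1 / (norm a + 1)) *\<^sub>R a"
  have M: "norm a + 1 > 0" by (simp add: add_nonneg_pos)
  then have "norm b \<le> 1" by (simp add: b_def divide_simps)
  moreover have "adj b = b" by (simp add: b_def adj_scaleR assms)
  ultimately have "norm_positive (b * b)"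
    unfolding norm_positive_def using sa_square_bound by (intro exI[of _ 1]) auto
  then show ?thesis using M unfolding b_def by (simp add: norm_positive_scaleR_iff)
qed

text \<open>Triangle inequality for s + t = (s + h) + (t - h), whose last summand has norm at most
  t.\<close>

lemma norm_positive_lower_bound:
  assumes "norm_positive h" "s \<ge> 0"
  shows "norm (s *\<^sub>R x + h * x) \<ge> s * norm x"
proof -
  obtain t where t: "t \<ge> 0" "norm (t *\<^sub>R x - h * x) \<le> t * norm x"
    using assms unfolding norm_positive_def by blast
  have "(s + t) *\<^sub>R x = (s *\<^sub>R x + h * x) + (t *\<^sub>R x - h * x)" by (simp add: algebra_simps)
  then have "norm ((s + t) *\<^sub>R x) \<le> norm (s *\<^sub>R x + h * x) + norm (t *\<^sub>R x - h * x)"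
    using norm_triangle_ineq by metis
  then show ?thesis using t assms(2) by (simp add: distrib_right)
qed

text \<open>\<open>a\<close> and \<open>b\<close> are twice the real and imaginary parts of
  \<open>z\<close>; the sum of their squares is twice the element in question.\<close>

lemma norm_positive_adj_mult_sum:
  fixes z :: "'a::cstar_algebra"
  shows "norm_positive (adj z * z + z * adj z)"
proof -
  define a b where "a = z + adj z" and "b = cscale \<i> (adj z - z)"
  have neg: "cscale \<i> (z - adj z) = - b"
    using cscale_minus_right[of \<i> "adj z - z"] by (simp add: b_def)
  have "adj a = a" by (simp add: a_def adj_add adj_adj add.commute)
  moreover have "adj b = b" using neg by (simp add: b_def adj_cscale adj_diff adj_adj)
  moreover have "b * b = - ((adj z - z) * (adj z - z))"
    unfolding b_def cscale_mult_left cscale_mult_right cscale_cscale by simp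
  ultimately have "norm_positive (a * a - (adj z - z) * (adj z - z))"
    using norm_positive_add[OF norm_positive_square norm_positive_square, of a b] by simp
  also have "a * a - (adj z - z) * (adj z - z) = 2 *\<^sub>R (adj z * z + z * adj z)"
    by (simp add: a_def algebra_simps scaleR_2)
  finally show ?thesis by (simp add: norm_positive_scaleR_iff)
qed

text \<open>By the previous lemma \<open>z * adj z\<close> is positive. As \<open>z\<close>
  intertwines it with \<open>adj z * z\<close>, powers of one operator that grow are tied to powers
  of another that stay bounded. This replaces comparing the spectra of the two products.\<close>

lemma eq_0_if_norm_positive_uminus_adj_mult:
  fixes z :: "'a::cstar_algebra"
  assumes "norm_positive (- (adj z * z))"
  shows "z = 0"
proof -
  obtain t where t: "t \<ge> 0" "\<And>x. norm (t *\<^sub>R x - (- (adj z * z)) * x) \<le> t * norm x"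
    using assms unfolding norm_positive_def by blast
  show ?thesis
  proof (cases "t = 0")
    case True
    have "norm (adj z * z * adj (adj z * z)) \<le> 0" using t(2)[of "adj (adj z * z)"] True by simp
    then show ?thesis by (simp only: norm_le_zero_iff mult_adj_eq_0_iff adj_mult_eq_0_iff)
  next
    case False
    with t have t0: "t > 0" by simp
    define \<alpha> \<pi> where "\<alpha> = (1 / t) *\<^sub>R (z * adj z)" and "\<pi> = (1 / t) *\<^sub>R (adj z * z)"
    define dbl where "dbl h = 2 *\<^sub>R h + h * h" for h :: 'a
    \<comment> \<open>In the unitization \<open>1 + \<beta> j = (1 + \<alpha>)\<close> to the power \<open>2 ^ j\<close>, and likewise for \<open>\<gamma>\<close> and \<open>\<pi>\<close>.\<close>
    define \<beta> \<gamma> where "\<beta> j = (dbl ^^ j) \<alpha>" and "\<gamma> j = (dbl ^^ j) \<pi>" for j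
    have \<beta>0: "\<beta> 0 = \<alpha>" and \<beta>S: "\<beta> (Suc j) = 2 *\<^sub>R \<beta> j + \<beta> j * \<beta> j"
      and \<gamma>0: "\<gamma> 0 = \<pi>" and \<gamma>S: "\<gamma> (Suc j) = 2 *\<^sub>R \<gamma> j + \<gamma> j * \<gamma> j" for j
      by (simp_all add: \<beta>_def \<gamma>_def dbl_def)
    have "norm_positive (z * adj z)"
      using norm_positive_add[OF norm_positive_adj_mult_sum[of z] assms] by simp
    then have p\<alpha>: "norm_positive \<alpha>" unfolding \<alpha>_def using t0 by (simp add: norm_positive_scaleR_iff)
    have sa: "adj (\<beta> j) = \<beta> j" for j
      by (induction j) (simp_all add: \<beta>0 \<beta>S \<alpha>_def adj_scaleR adj_mult adj_adj adj_add)
    have pos: "norm_positive (\<beta> j)" for j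
    proof (induction j)
      case (Suc j)
      then show ?case unfolding \<beta>S
        by (intro norm_positive_add norm_positive_scaleR norm_positive_square sa) auto
    qed (simp add: \<beta>0 p\<alpha>)
    \<comment> \<open>Each squaring at least doubles: the lower bound is applied with
      \<open>s = 2\<close> to the vector \<open>\<beta> j * x\<close>.\<close>
    have grow: "2 ^ j * norm (\<alpha> * x) \<le> norm (\<beta> j * x)" for j x
    proof (induction j)
      case (Suc j)
      have "2 * norm (\<beta> j * x) \<le> norm (2 *\<^sub>R (\<beta> j * x) + \<beta> j * (\<beta> j * x))"
        by (rule norm_positive_lower_bound[OF pos]) simp
      also have "\<dots> = norm (\<beta> (Suc j) * x)" by (simp add: \<beta>S algebra_simps)
      finally show ?case using Suc by simp
    qed (simp add: \<beta>0)
    have contr: "norm (x + \<gamma> j * x) \<le> norm x" for j x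
    proof (induction j arbitrary: x)
      case 0
      have "x + \<gamma> 0 * x = (1 / t) *\<^sub>R (t *\<^sub>R x - (- (adj z * z)) * x)"
        using t0 by (simp add: \<gamma>0 \<pi>_def algebra_simps)
      then show ?case using t(2)[of x] t0 by (simp add: divide_simps mult.commute)
    next
      case (Suc j)
      have "x + \<gamma> (Suc j) * x = (x + \<gamma> j * x) + \<gamma> j * (x + \<gamma> j * x)"
        by (simp add: \<gamma>S algebra_simps scaleR_2)
      then show ?case using order_trans[OF Suc[of "x + \<gamma> j * x"] Suc[of x]] by (simp only:)
    qed
    have inter: "\<beta> j * z = z * \<gamma> j" for j
    proof (induction j)
      case (Suc j)
      have "\<beta> j * \<beta> j * z = z * (\<gamma> j * \<gamma> j)" by (metis Suc mult.assoc)
      then show ?case using Suc by (simp add: \<beta>S \<gamma>S algebra_simps)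
    qed (simp add: \<beta>0 \<gamma>0 \<alpha>_def \<pi>_def algebra_simps)
    have "norm (\<alpha> * (z * y)) \<le> 0" for y
    proof (rule ccontr)
      assume "\<not> norm (\<alpha> * (z * y)) \<le> 0"
      then have p: "norm (\<alpha> * (z * y)) > 0" by simp
      obtain j where "2 * (norm z * norm y) / norm (\<alpha> * (z * y)) < 2 ^ j"
        using real_arch_pow[of 2] by auto
      then have "2 * (norm z * norm y) < 2 ^ j * norm (\<alpha> * (z * y))"
        using p by (simp add: divide_simps)
      also have "\<dots> \<le> norm (\<beta> j * (z * y))" by (rule grow)
      \<comment> \<open>Moving \<open>z\<close> to the left trades the growing operator for the
        contraction \<open>y + \<gamma> j * y\<close>.\<close>
      also have "\<beta> j * (z * y) = z * (y + \<gamma> j * y) - z * y"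
        using inter[of j] by (simp add: distrib_left) (metis mult.assoc)
      also have "norm \<dots> \<le> norm (z * (y + \<gamma> j * y)) + norm (z * y)" by (rule norm_triangle_ineq4)
      also have "\<dots> \<le> norm z * norm y + norm z * norm y"
        by (intro add_mono norm_mult_ineq order_trans[OF norm_mult_ineq] mult_left_mono contr) simp
      finally show False by simp
    qed
    from this[of "adj z"] have "(z * adj z) * adj (z * adj z) = 0"
      using t0 by (simp add: \<alpha>_def adj_mult adj_adj divide_le_0_iff)
    then show ?thesis by (simp only: mult_adj_eq_0_iff)
  qed
qed

text \<open>With \<open>h = x\<^sup>* x\<close> and \<open>m = \<bar>h\<bar> - h\<close> one has \<open>(x m)\<^sup>* (x m) = - \<bar>h\<bar> m\<^sup>2 \<le> 0\<close>, so the negative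
  part of \<open>h\<close> vanishes.\<close>

lemma adj_mult_abs:
  fixes x :: "'a::cstar_algebra"
  assumes le: "norm x \<le> 1"
  shows "norm_positive (adj x * x)"
    and "\<And>y. (adj x * x) * (adj x * x) * y = y * ((adj x * x) * (adj x * x))
      \<Longrightarrow> (adj x * x) * y = y * (adj x * x)"
proof -
  define h where "h = adj x * x"
  have sah: "adj h = h" by (simp add: h_def adj_mult adj_adj)
  have "norm h \<le> 1" unfolding h_def cstar_identity using le by (simp add: mult_le_one)
  then have bd: "norm (y - h * h * y) \<le> norm y" for y by (rule sa_square_bound[OF sah])
  have "adj (h * h) = h * h" by (simp add: adj_mult sah)
  from sa_sqrt[OF this bd] obtain c where c: "adj c = c" "c * c = h * h"
    and cb: "\<forall>x. norm (x - c * x) \<le> norm x"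
    and cc: "\<forall>y. h * h * y = y * (h * h) \<longrightarrow> c * y = y * c" by blast
  \<comment> \<open>The second root \<open>e\<close> is needed to exhibit \<open>m * (c * m)\<close>
    as the square of the self-adjoint \<open>e * m\<close>.\<close>
  from sa_sqrt[OF c(1) spec[OF cb]] obtain e where e: "adj e = e" "e * e = c"
    and ec: "\<forall>y. c * y = y * c \<longrightarrow> e * y = y * e" by blast
  have ch: "c * h = h * c" using spec[OF cc, of h] by (simp add: mult.assoc)
  define m where "m = c - h"
  have sam: "adj m = m" by (simp add: m_def adj_diff c sah)
  have cm: "c * m = m * c" by (simp add: m_def algebra_simps ch)
  have em: "e * m = m * e" using ec cm by blast
  have hm: "h * m = - (c * m)" by (simp add: m_def algebra_simps ch c(2))
  have "adj (x * m) * (x * m) = m * (h * m)" by (simp add: adj_mult sam h_def mult.assoc)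
  also have "\<dots> = - ((e * m) * (e * m))"
  proof -
    have "(e * m) * (e * m) = m * (e * e) * m" using em by (metis mult.assoc)
    then show ?thesis by (simp add: hm e(2) mult.assoc)
  qed
  finally have eq: "adj (x * m) * (x * m) = - ((e * m) * (e * m))" .
  have "adj (e * m) = e * m" by (simp add: adj_mult sam e em)
  then have "norm_positive ((e * m) * (e * m))" by (rule norm_positive_square)
  then have "x * m = 0" using eq by (intro eq_0_if_norm_positive_uminus_adj_mult) simp
  then have hm0: "h * m = 0" by (simp add: h_def mult.assoc)
  then have "c * m = 0" using hm by simp
  then have "m * m = 0" using hm0 by (simp add: m_def left_diff_distrib)
  then have "adj m * m = 0" by (simp add: sam)
  then have hc: "h = c" by (simp add: m_def)
  show "norm_positive (adj x * x)"
    unfolding h_def[symmetric] hc norm_positive_def using cb by (intro exI[of _ 1]) auto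
  show "(adj x * x) * y = y * (adj x * x)"
    if "(adj x * x) * (adj x * x) * y = y * ((adj x * x) * (adj x * x))" for y
    using cc that unfolding h_def[symmetric] hc by blast
qed

lemma norm_positive_adj_mult: "norm_positive (adj x * (x::'a::cstar_algebra))"
  and commute_adj_mult_if_commute_square:
    "(adj x * x) * (adj x * x) * y = y * ((adj x * x) * (adj x * x))
      \<Longrightarrow> (adj x * x) * y = y * (adj x * x)"
proof -
  define M where "M = 1 / (norm x + 1)"
  have "norm x + 1 > 0" by (simp add: add_nonneg_pos)
  then have M: "M > 0" and le: "norm (M *\<^sub>R x) \<le> 1" by (simp_all add: M_def divide_simps)
  have eq: "adj (M *\<^sub>R x) * (M *\<^sub>R x) = (M * M) *\<^sub>R (adj x * x)" by (simp add: adj_scaleR)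
  have MM: "M * M > 0" using M by simp
  note * = adj_mult_abs[OF le, unfolded eq]
  show "norm_positive (adj x * x)" using *(1) MM by (simp only: norm_positive_scaleR_iff)
  show "(adj x * x) * y = y * (adj x * x)"
    if "(adj x * x) * (adj x * x) * y = y * ((adj x * x) * (adj x * x))"
    using *(2)[of y] that M by simp
qed

text \<open>Each summand is minus the other, so \<open>adj x * x\<close> is both positive and
  negative.\<close>

lemma sum_adj_mult_eq_0D:
  fixes x y :: "'a::cstar_algebra"
  assumes "adj x * x + adj y * y = 0"
  shows "x = 0"
proof (rule eq_0_if_norm_positive_uminus_adj_mult)
  have "- (adj x * x) = adj y * y" using assms by (simp add: minus_unique)
  then show "norm_positive (- (adj x * x))" using norm_positive_adj_mult[of y] by simp
qed

text \<open>Anticommuting with s = \<open>adj b * b\<close> implies commuting with s^2, hence with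
  its positive root s. Both relations together give s a = a s = 0, and the C*-identity strips one
  factor of s.\<close>

lemma anticommute_adj_mult_iff:
  fixes a b :: "'a::cstar_algebra"
  shows "a * (adj b * b) + (adj b * b) * a = 0 \<longleftrightarrow> b * a = 0 \<and> a * adj b = 0"
proof
  let ?s = "adj b * b"
  assume 0: "a * ?s + ?s * a = 0"
  then have anti: "a * ?s = - (?s * a)" by (simp add: eq_neg_iff_add_eq_0)
  have "s * s * a = a * (s * s)" if "a * s = - (s * a)" for s
  proof -
    have "a * s * s = s * s * a" using that by (simp add: mult.assoc)
    then show ?thesis by (simp add: mult.assoc)
  qed
  then have "?s * ?s * a = a * (?s * ?s)" using anti by blast
  then have "?s * a = a * ?s" by (rule commute_adj_mult_if_commute_square)
  with 0 have "2 *\<^sub>R (?s * a) = 0" by (simp add: scaleR_2)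
  then have sa: "?s * a = 0" by simp
  then have as: "a * ?s = 0" using anti by simp
  have "adj (b * a) * (b * a) = adj a * (?s * a)" by (simp add: adj_mult mult.assoc)
  then have "b * a = 0" using sa by simp
  moreover have "(a * adj b) * adj (a * adj b) = (a * ?s) * adj a"
    by (simp add: adj_mult adj_adj mult.assoc)
  then have "a * adj b = 0" using as by (metis mult_zero_left mult_adj_eq_0_iff)
  ultimately show "b * a = 0 \<and> a * adj b = 0" ..
next
  assume "b * a = 0 \<and> a * adj b = 0"
  then show "a * (adj b * b) + (adj b * b) * a = 0"
    by (metis add.right_neutral mult.assoc mult_zero_left mult_zero_right)
qed


section \<open>Annihilators\<close>

lemma pos_in_subset:
  assumes "cstar_subalgebra B"
  shows "pos_in B \<subseteq> B"
  using assms unfolding pos_in_def cstar_subalgebra_def by blast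

text \<open>The symmetric condition in \<open>Ann\<close> is not visibly stable under products; the
  two-sided one is.\<close>

lemma Ann_pos_in:
  assumes "S \<subseteq> pos_in B"
  shows "Ann B S = {a \<in> B. \<forall>s\<in>S. a * s = 0 \<and> s * a = 0}"
proof -
  have "a * s + s * a = 0 \<longleftrightarrow> a * s = 0 \<and> s * a = 0" if "s \<in> S" for a s
  proof -
    obtain b where s: "s = adj b * b" using assms \<open>s \<in> S\<close> unfolding pos_in_def by blast
    show ?thesis
    proof
      assume "a * s + s * a = 0"
      then have "b * a = 0" "a * adj b = 0" unfolding s anticommute_adj_mult_iff by auto
      then show "a * s = 0 \<and> s * a = 0" unfolding s by (metis mult.assoc mult_zero_left mult_zero_right)
    qed simp
  qed
  then show ?thesis unfolding Ann_def by blast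
qed

lemma two_sided_ann_cstar_subalgebra:
  assumes B: "cstar_subalgebra B" and S: "\<And>s. s \<in> S \<Longrightarrow> adj s \<in> S"
  shows "cstar_subalgebra {a \<in> B. \<forall>s\<in>S. a * s = 0 \<and> s * a = 0}"
proof -
  have "closed {a \<in> B. \<forall>s\<in>S. a * s = 0 \<and> s * a = 0}"
  proof -
    have "{a \<in> B. \<forall>s\<in>S. a * s = 0 \<and> s * a = 0} = B \<inter> (\<Inter>s\<in>S. {a. a * s = 0} \<inter> {a. s * a = 0})"
      by auto
    moreover have "closed B" using B unfolding cstar_subalgebra_def by blast
    ultimately show ?thesis
      by (auto intro!: closed_Int closed_INT closed_Collect_eq continuous_intros)
  qed
  moreover have "adj a * s = 0 \<and> s * adj a = 0" if "\<forall>s\<in>S. a * s = 0 \<and> s * a = 0" "s \<in> S" for a s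
  proof -
    have "a * adj s = 0" "adj s * a = 0" using that S by auto
    then have "adj (a * adj s) = 0" "adj (adj s * a) = 0" by simp_all
    then show ?thesis by (simp add: adj_mult adj_adj)
  qed
  moreover have "cscale c 0 = (0::'a)" for c
    using cscale_diff_right[of c 0 0] by simp
  ultimately show ?thesis using B unfolding cstar_subalgebra_def
    by (auto simp: distrib_left distrib_right cscale_mult_left cscale_mult_right mult.assoc)
      (metis mult.assoc mult_zero_left)
qed

lemma pos_in_self_adjoint: "s \<in> pos_in B \<Longrightarrow> adj s = s"
  unfolding pos_in_def by (auto simp: adj_mult adj_adj)

lemma Ann_cstar_subalgebra:
  assumes "cstar_subalgebra B" "S \<subseteq> pos_in B"
  shows "cstar_subalgebra (Ann B S)"
  unfolding Ann_pos_in[OF assms(2)]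
  by (rule two_sided_ann_cstar_subalgebra[OF assms(1)]) (use assms(2) pos_in_self_adjoint in force)

text \<open>The elements \<open>adj b * b\<close>, with \<open>b\<close> running through
  \<open>c\<close> and \<open>adj c\<close>, force both products with \<open>c\<close> to vanish.
  Since \<open>Plattice\<close> starts from positive sets, a subalgebra can thus be replaced by its
  positive part.\<close>

lemma Ann_of_pos_part:
  assumes B: "cstar_subalgebra B" and C: "cstar_subalgebra C" "C \<subseteq> B"
  shows "Ann B (pos_in C) = Ann B C"
    and "Ann B C = {a \<in> B. \<forall>c\<in>C. a * c = 0 \<and> c * a = 0}"
proof -
  have "Ann B (pos_in C) \<subseteq> {a \<in> B. \<forall>c\<in>C. a * c = 0 \<and> c * a = 0}"
  proof
    fix a assume a: "a \<in> Ann B (pos_in C)"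
    have *: "b * a = 0 \<and> a * adj b = 0" if "b \<in> C" for b
    proof -
      have "adj b * b \<in> pos_in C" using that unfolding pos_in_def by blast
      then show ?thesis
        using a anticommute_adj_mult_iff[of a b] unfolding Ann_def by auto
    qed
    have "a * c = 0" if "c \<in> C" for c
    proof -
      have "adj c \<in> C" using that C(1) unfolding cstar_subalgebra_def by blast
      from *[OF this] show ?thesis by (simp add: adj_adj)
    qed
    then show "a \<in> {a \<in> B. \<forall>c\<in>C. a * c = 0 \<and> c * a = 0}"
      using a * unfolding Ann_def by blast
  qed
  moreover have "{a \<in> B. \<forall>c\<in>C. a * c = 0 \<and> c * a = 0} \<subseteq> Ann B C" unfolding Ann_def by auto
  moreover have "Ann B C \<subseteq> Ann B (pos_in C)"
    using pos_in_subset[OF C(1)] unfolding Ann_def by blast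
  ultimately show "Ann B (pos_in C) = Ann B C"
    "Ann B C = {a \<in> B. \<forall>c\<in>C. a * c = 0 \<and> c * a = 0}" by blast+
qed

lemma Ann_subset: "Ann B S \<subseteq> B"
  unfolding Ann_def by blast

lemma Ann_antimono: "S \<subseteq> T \<Longrightarrow> Ann B T \<subseteq> Ann B S"
  unfolding Ann_def by blast

lemma subset_Ann_Ann: "S \<subseteq> B \<Longrightarrow> S \<subseteq> Ann B (Ann B S)"
  unfolding Ann_def by (auto simp: add.commute)

text \<open>Annihilating three times is the same as once; the witness is the positive part of
  \<open>Ann B S\<close>.\<close>

lemma Ann_in_Plattice:
  assumes B: "cstar_subalgebra B" and S: "S \<subseteq> pos_in B"
  shows "Ann B S \<in> Plattice B"
proof -
  let ?C = "Ann B S"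
  note C = Ann_cstar_subalgebra[OF B S]
  have "S \<subseteq> B" using S pos_in_subset[OF B] by blast
  then have "Ann B (Ann B ?C) = ?C"
    by (intro equalityI Ann_antimono subset_Ann_Ann Ann_subset)
  moreover have "Ann B (pos_in ?C) = Ann B ?C" by (rule Ann_of_pos_part(1)[OF B C Ann_subset])
  moreover have "pos_in ?C \<subseteq> pos_in B" using Ann_subset[of B S] unfolding pos_in_def by blast
  ultimately show ?thesis unfolding Plattice_def by (metis (mono_tags, lifting) mem_Collect_eq)
qed

text \<open>The members of \<open>T\<close> play the role of Hilbert space vectors and the set that
  of the operators living on their orthogonal complement. It is the annihilator of the positive
  elements \<open>\<tau> * adj \<tau>\<close>.\<close>

definition vector_ann :: "'a::cstar_algebra set \<Rightarrow> 'a set \<Rightarrow> 'a set" where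
  "vector_ann B T = {a \<in> B. \<forall>\<tau>\<in>T. a * \<tau> = 0 \<and> adj \<tau> * a = 0}"

lemma vector_ann_in_Plattice:
  assumes B: "cstar_subalgebra B" and T: "T \<subseteq> B"
  shows "vector_ann B T \<in> Plattice B"
proof -
  let ?S = "(\<lambda>\<tau>. adj (adj \<tau>) * adj \<tau>) ` T"
  have "adj ` T \<subseteq> B" using B T unfolding cstar_subalgebra_def by blast
  then have "?S \<subseteq> pos_in B" unfolding pos_in_def by blast
  then have "Ann B ?S \<in> Plattice B" by (rule Ann_in_Plattice[OF B])
  also have "Ann B ?S = vector_ann B T"
    unfolding Ann_def vector_ann_def ball_simps anticommute_adj_mult_iff
    by (auto simp: adj_adj)
  finally show ?thesis .
qed

text \<open>\<open>\<psi> * adj \<psi>\<close> is the analogue of the rank-one operator of a vector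
  orthogonal to \<open>T\<close>.\<close>

lemma mult_adj_in_vector_ann:
  assumes B: "cstar_subalgebra B" "\<psi> \<in> B" and 0: "\<And>\<tau>. \<tau> \<in> T \<Longrightarrow> adj \<tau> * \<psi> = 0"
  shows "\<psi> * adj \<psi> \<in> vector_ann B T"
proof -
  have "\<psi> * adj \<psi> * \<tau> = 0 \<and> adj \<tau> * (\<psi> * adj \<psi>) = 0" if "\<tau> \<in> T" for \<tau>
  proof -
    have "adj \<psi> * \<tau> = adj (adj \<tau> * \<psi>)" by (simp add: adj_mult adj_adj)
    then have "adj \<psi> * \<tau> = 0" using 0[OF that] by simp
    then show ?thesis using 0[OF that] by (metis mult.assoc mult_zero_left mult_zero_right)
  qed
  then show ?thesis using B unfolding vector_ann_def cstar_subalgebra_def by blast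
qed

text \<open>Compressing \<open>b\<close> by an annihilated \<open>c\<close> gives 0 as a sum of two
  positive elements, so the factor \<open>d\<close> of the smaller element kills \<open>c\<close>.
  The third claim lets membership be tested by products.\<close>

lemma Plattice_hereditary:
  assumes "V \<in> Plattice (UNIV::'a::cstar_algebra set)"
  shows "hereditary V" and "cstar_subalgebra V"
    and "\<exists>C. V = {a. \<forall>c\<in>C. a * c = 0 \<and> c * a = 0}"
proof -
  obtain S where S: "S \<subseteq> pos_in UNIV" and V: "V = Ann UNIV (Ann UNIV S)"
    using assms unfolding Plattice_def by blast
  have U: "cstar_subalgebra (UNIV::'a set)" unfolding cstar_subalgebra_def by simp
  define C where "C = Ann UNIV S"
  have C: "cstar_subalgebra C" unfolding C_def by (rule Ann_cstar_subalgebra[OF U S])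
  then have adjC: "adj c \<in> C" if "c \<in> C" for c using that unfolding cstar_subalgebra_def by blast
  have VC: "V = {a. \<forall>c\<in>C. a * c = 0 \<and> c * a = 0}"
    using Ann_of_pos_part(2)[OF U C] unfolding V C_def by simp
  then show "\<exists>C. V = {a. \<forall>c\<in>C. a * c = 0 \<and> c * a = 0}" by blast
  show sub: "cstar_subalgebra V"
    using two_sided_ann_cstar_subalgebra[OF U adjC] unfolding VC by simp
  have "a \<in> V" if b: "b \<in> V" and a: "positive a" and ba: "positive (b - a)" for a b
  proof -
    obtain d e where d: "a = adj d * d" and e: "b - a = adj e * e"
      using a ba unfolding positive_def pos_in_def by blast
    have dc: "d * c = 0" if "c \<in> C" for c
    proof (rule sum_adj_mult_eq_0D)
      have "b = adj d * d + adj e * e" using e unfolding d by (simp add: algebra_simps)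
      then have "adj (d * c) * (d * c) + adj (e * c) * (e * c) = adj c * (b * c)"
        by (simp add: adj_mult algebra_simps)
      then show "adj (d * c) * (d * c) + adj (e * c) * (e * c) = 0"
        using b that unfolding VC by simp
    qed
    have cd: "c * adj d = 0" if "c \<in> C" for c
    proof -
      have "adj (d * adj c) = 0" using dc[OF adjC[OF that]] by simp
      then show ?thesis by (simp add: adj_mult adj_adj)
    qed
    show ?thesis unfolding VC d using dc cd
      by (auto simp: mult.assoc) (simp add: mult.assoc[symmetric])
  qed
  then show "hereditary V" using sub unfolding hereditary_def by blast
qed

section \<open>Shifts and the pentagon\<close>

text \<open>\<open>v\<close> acts as an isometry on the corner of \<open>p\<close> with range
  projection \<open>q\<close>; it shifts the defect \<open>r = p - q\<close> through pairwise
  orthogonal copies.\<close>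

lemma infinite_projection_shift:
  fixes V :: "'a::cstar_algebra set"
  assumes V: "V \<in> Plattice UNIV" and p: "p \<in> V" "infinite_projection p"
  obtains e :: "nat \<Rightarrow> 'a" and r where "\<And>n. e n \<in> V" "r \<noteq> 0"
    "\<And>m n. adj (e m) * e n = (if m = n then r else 0)"
proof -
  obtain q v where pp: "p * p = p" "adj p = p" and qq: "q * q = q" "adj q = q"
    and qp: "q * p = q" "q \<noteq> p" and v: "adj v * v = p" "v * adj v = q"
    using p(2) unfolding infinite_projection_def is_projection_def mvn_equiv_def by blast
  have "adj (q * p) = adj q" using qp by simp
  then have pq: "p * q = q" by (simp add: adj_mult pp qq)
  have qv: "q * v = v"
  proof -
    let ?w = "v - q * v"
    have "?w * adj ?w = v * adj v - v * adj v * adj q - (q * (v * adj v) - q * (v * adj v) * adj q)"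
      by (simp add: adj_diff adj_mult algebra_simps)
    then have "?w * adj ?w = 0" by (simp add: v qq)
    then have "?w = 0" by (simp only: mult_adj_eq_0_iff)
    then show ?thesis by simp
  qed
  have vp: "v * p = v"
  proof -
    let ?w = "v - v * p"
    have "adj ?w * ?w = adj v * v - adj v * v * p - (adj p * (adj v * v) - adj p * (adj v * v) * p)"
      by (simp add: adj_diff adj_mult algebra_simps)
    then have "adj ?w * ?w = 0" by (simp add: v pp)
    then have "?w = 0" by (simp only: adj_mult_eq_0_iff)
    then show ?thesis by simp
  qed
  have pv: "p * v = v" by (metis qv pq mult.assoc)
  obtain C where C: "V = {a. \<forall>c\<in>C. a * c = 0 \<and> c * a = 0}" using Plattice_hereditary(3)[OF V] by blast
  \<comment> \<open>The equivalence only supplies \<open>v\<close> in the whole algebra;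
    \<open>v * p = v\<close> and \<open>p * v = v\<close> place it in \<open>V\<close>.\<close>
  have "v * c = 0 \<and> c * v = 0" if "c \<in> C" for c
  proof -
    have "p * c = 0" "c * p = 0" using p(1) that unfolding C by auto
    then show ?thesis by (metis vp pv mult.assoc mult_zero_left mult_zero_right)
  qed
  then have vV: "v \<in> V" unfolding C by blast
  note sub = Plattice_hereditary(2)[OF V]
  then have mV: "x * y \<in> V" and aV: "adj x \<in> V" and dV: "x - y \<in> V" if "x \<in> V" "y \<in> V" for x y
  proof -
    show "x * y \<in> V" "adj x \<in> V" using sub that unfolding cstar_subalgebra_def by blast+
    have "cscale (- 1) y \<in> V" using sub that unfolding cstar_subalgebra_def by blast
    then have "- y \<in> V" by simp
    then have "x + - y \<in> V" using sub that(1) unfolding cstar_subalgebra_def by blast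
    then show "x - y \<in> V" by simp
  qed
  define r where "r = p - q"
  have r: "adj r = r" "r * r = r" "p * r = r" "r * v = 0" "r \<noteq> 0"
    using qp(2)[symmetric] by (simp_all add: r_def adj_diff pp qq algebra_simps qp pq pv qv)
  have "q \<in> V" using mV[OF vV aV[OF vV vV]] v by simp
  then have rV: "r \<in> V" unfolding r_def using dV p(1) by blast
  define e where "e n = ((*) v ^^ n) r" for n
  have e0: "e 0 = r" and eS: "e (Suc n) = v * e n" for n by (simp_all add: e_def)
  have eV: "e n \<in> V" for n by (induction n) (simp_all add: e0 eS rV mV vV)
  have pe: "p * e n = e n" for n
    by (cases n) (simp_all add: e0 eS r mult.assoc[symmetric] pv)
  \<comment> \<open>Common factors cancel through \<open>adj v * v = p\<close>, leaving
    \<open>r * v = 0\<close>.\<close>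
  have lt: "adj (e m) * e (m + Suc n) = 0" for m n
  proof (induction m)
    case 0
    have "r * (v * e n) = 0" by (simp add: mult.assoc[symmetric] r)
    then show ?case by (simp add: e0 eS r)
  next
    case (Suc m)
    have "adj (e (Suc m)) * e (Suc m + Suc n) = adj (e m) * ((adj v * v) * e (m + Suc n))"
      by (simp add: eS adj_mult mult.assoc)
    then show ?case using Suc by (simp add: v pe)
  qed
  have eq: "adj (e m) * e m = r" for m
  proof (induction m)
    case (Suc m)
    have "adj (e (Suc m)) * e (Suc m) = adj (e m) * ((adj v * v) * e m)"
      by (simp add: eS adj_mult mult.assoc)
    then show ?case using Suc by (simp add: v pe)
  qed (simp add: e0 r)
  have "adj (e m) * e n = (if m = n then r else 0)" for m n
  proof -
    consider "m = n" | "m < n" | "n < m" by linarith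
    then show ?thesis
    proof cases
      case 2
      then obtain k where "n = m + Suc k" using less_imp_Suc_add by auto
      then show ?thesis using lt[of m k] by simp
    next
      case 3
      then obtain k where k: "m = n + Suc k" using less_imp_Suc_add by auto
      have "adj (e m) * e n = adj (adj (e n) * e m)" by (simp add: adj_mult adj_adj)
      then show ?thesis using lt[of n k] k by simp
    qed (simp add: eq)
  qed
  then show thesis using that[of e r] eV r(5) by blast
qed

lemma not_modular_if_orthonormal_sequences:
  fixes V :: "'a::cstar_algebra set" and \<epsilon> \<phi> :: "nat \<Rightarrow> 'a"
  assumes V: "cstar_subalgebra V" and eV: "\<And>n. \<epsilon> n \<in> V" and fV: "\<And>n. \<phi> n \<in> V" and r0: "r \<noteq> 0"
    and ee: "\<And>m n. adj (\<epsilon> m) * \<epsilon> n = (if m = n then r else 0)"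
    and ff: "\<And>m n. adj (\<phi> m) * \<phi> n = (if m = n then r else 0)"
    and ef: "\<And>m n. adj (\<epsilon> m) * \<phi> n = 0"
  shows "\<not> modular_lattice (Plattice V)"
proof
  assume "modular_lattice (Plattice V)"
  then have modular: "\<And>x y z m l j r. x \<in> Plattice V \<Longrightarrow> y \<in> Plattice V \<Longrightarrow> z \<in> Plattice V \<Longrightarrow>
      x \<subseteq> z \<Longrightarrow> is_inf_in (Plattice V) y z m \<Longrightarrow> is_sup_in (Plattice V) x m l \<Longrightarrow>
      is_sup_in (Plattice V) x y j \<Longrightarrow> is_inf_in (Plattice V) j z r \<Longrightarrow> l = r"
    unfolding modular_lattice_def by (elim conjE) blast
  have closedV: "closed V" and addV: "\<And>x y. x \<in> V \<Longrightarrow> y \<in> V \<Longrightarrow> x + y \<in> V"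
    and adjV: "\<And>x. x \<in> V \<Longrightarrow> adj x \<in> V" and V0: "0 \<in> V"
    and scV: "\<And>c x. x \<in> V \<Longrightarrow> c *\<^sub>R x \<in> V"
    using V unfolding cstar_subalgebra_def by (auto simp flip: cscale_of_real)
  have diffV: "x - y \<in> V" if "x \<in> V" "y \<in> V" for x y
    using addV[OF that(1) scV[OF that(2), of "- 1"]] by simp
  have fe: "adj (\<phi> m) * \<epsilon> n = 0" for m n
  proof -
    have "adj (\<phi> m) * \<epsilon> n = adj (adj (\<epsilon> n) * \<phi> m)" by (simp add: adj_mult adj_adj)
    then show ?thesis by (simp add: ef)
  qed
  have rsa: "adj r = r" using ee[of 0 0] by (metis adj_adj adj_mult)
  define K where "K = norm (\<epsilon> 0)"
  have ne: "norm (\<epsilon> n) = K" for n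
  proof -
    have "norm (\<epsilon> n) * norm (\<epsilon> n) = norm (\<epsilon> 0) * norm (\<epsilon> 0)"
      unfolding cstar_identity[symmetric] by (simp add: ee)
    then show ?thesis by (simp add: K_def flip: power2_eq_square)
  qed
  have nf: "norm (\<phi> n) = K" for n
  proof -
    have "norm (\<phi> n) * norm (\<phi> n) = norm (\<epsilon> 0) * norm (\<epsilon> 0)"
      unfolding cstar_identity[symmetric] by (simp add: ee ff)
    then show ?thesis by (simp add: K_def flip: power2_eq_square)
  qed
  \<comment> \<open>The weights ensure convergence, never vanish, and make
    \<open>\<epsilon> n - 2 *\<^sub>R \<epsilon> (Suc n)\<close> orthogonal to
    \<open>\<xi>\<close>.\<close>
  define \<xi> where "\<xi> = (\<Sum>n. (1/2) ^ n *\<^sub>R \<epsilon> n)"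
  have "summable (\<lambda>n. K * (1/2::real) ^ n)" by (intro summable_mult summable_geometric) simp
  then have sm: "summable (\<lambda>n. (1/2) ^ n *\<^sub>R \<epsilon> n)"
    by (rule summable_comparison_test'[where N=0]) (simp add: ne)
  have "(\<Sum>i<n. (1/2) ^ i *\<^sub>R \<epsilon> i) \<in> V" for n
    by (induction n) (simp_all add: V0 addV scV eV)
  then have \<xi>V: "\<xi> \<in> V" unfolding \<xi>_def
    by (rule closed_sequentially[OF closedV _ summable_LIMSEQ[OF sm]])
  have e\<xi>: "adj (\<epsilon> k) * \<xi> = (1/2) ^ k *\<^sub>R r" for k
  proof -
    have "(\<lambda>n. adj (\<epsilon> k) * ((1/2) ^ n *\<^sub>R \<epsilon> n)) sums (adj (\<epsilon> k) * \<xi>)"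
      unfolding \<xi>_def by (rule bounded_linear.sums[OF bounded_linear_mult_right summable_sums[OF sm]])
    moreover have "(\<lambda>n. adj (\<epsilon> k) * ((1/2) ^ n *\<^sub>R \<epsilon> n)) = (\<lambda>n. if n = k then (1/2) ^ n *\<^sub>R r else 0)"
      by (auto simp: ee)
    ultimately show ?thesis using sums_single[of k "\<lambda>n. (1/2) ^ n *\<^sub>R r"] sums_unique2 by fastforce
  qed
  have \<xi>e: "adj \<xi> * \<epsilon> k = (1/2) ^ k *\<^sub>R r" for k
  proof -
    have "adj \<xi> * \<epsilon> k = adj (adj (\<epsilon> k) * \<xi>)" by (simp add: adj_mult adj_adj)
    then show ?thesis by (simp add: e\<xi> adj_scaleR rsa)
  qed
  define x where "x = vector_ann V (range \<phi> \<union> {\<xi>})"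
  \<comment> \<open>The weight decays faster than that in \<open>\<xi>\<close>; the quotient 2^n of
    the two is what becomes unbounded when the join is computed.\<close>
  define y where "y = vector_ann V (range (\<lambda>n. \<phi> n - (1/4) ^ n *\<^sub>R \<epsilon> n))"
  define z where "z = vector_ann V (range \<phi>)"
  define D where "D = vector_ann V (range \<phi> \<union> range \<epsilon>)"
  have L: "x \<in> Plattice V" "y \<in> Plattice V" "z \<in> Plattice V" "D \<in> Plattice V" "vector_ann V {} \<in> Plattice V"
    unfolding x_def y_def z_def D_def using eV fV \<xi>V scV diffV
    by (auto intro!: vector_ann_in_Plattice[OF V])
  have emp: "vector_ann V {} = V" unfolding vector_ann_def by simp
  have xz: "x \<subseteq> z" unfolding x_def z_def vector_ann_def by blast
  have yzD: "y \<inter> z = D"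
  proof
    show "D \<subseteq> y \<inter> z" unfolding y_def z_def D_def vector_ann_def
      by (auto simp: algebra_simps adj_diff adj_scaleR)
    show "y \<inter> z \<subseteq> D"
    proof
      fix a assume "a \<in> y \<inter> z"
      then have a: "a \<in> V" "\<And>n. a * \<phi> n = 0" "\<And>n. adj (\<phi> n) * a = 0"
        "\<And>n. a * (\<phi> n - (1/4) ^ n *\<^sub>R \<epsilon> n) = 0" "\<And>n. adj (\<phi> n - (1/4) ^ n *\<^sub>R \<epsilon> n) * a = 0"
        unfolding y_def z_def vector_ann_def by auto
      have "a * \<epsilon> n = 0" "adj (\<epsilon> n) * a = 0" for n
        using a(2-5)[of n] by (simp_all add: right_diff_distrib left_diff_distrib adj_diff adj_scaleR)
      then show "a \<in> D" using a unfolding D_def vector_ann_def by auto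
    qed
  qed
  have Dx: "D \<subseteq> x"
  proof
    fix a assume "a \<in> D"
    then have a: "a \<in> V" "\<And>n. a * \<phi> n = 0" "\<And>n. adj (\<phi> n) * a = 0"
      "\<And>n. a * \<epsilon> n = 0" "\<And>n. adj (\<epsilon> n) * a = 0"
      unfolding D_def vector_ann_def by auto
    have *: "b * \<xi> = 0" if "\<And>n. b * \<epsilon> n = 0" for b
      unfolding \<xi>_def using bounded_linear.suminf[OF bounded_linear_mult_right[of b] sm] that by simp
    have "adj a * \<epsilon> n = adj (adj (\<epsilon> n) * a)" for n by (simp add: adj_mult adj_adj)
    then have "adj a * \<xi> = 0" using a(5) by (intro *) simp
    then have "adj (adj a * \<xi>) = 0" by simp
    then have "adj \<xi> * a = 0" by (simp add: adj_mult adj_adj)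
    then show "a \<in> x" using a *[OF a(4)] unfolding x_def vector_ann_def by auto
  qed
  have inf1: "is_inf_in (Plattice V) y z D" using L(4) yzD unfolding is_inf_in_def by blast
  have sup1: "is_sup_in (Plattice V) x D x" using L(1) Dx unfolding is_sup_in_def by blast
  have zV: "z \<subseteq> V" "x \<subseteq> V" "y \<subseteq> V" unfolding x_def y_def z_def vector_ann_def by blast+
  have inf2: "is_inf_in (Plattice V) V z z" using L(3) zV unfolding is_inf_in_def by blast
  have "x \<noteq> z"
  proof
    assume "x = z"
    \<comment> \<open>The separating vector \<open>\<epsilon> 0\<close> is orthogonal to every
      \<open>\<phi> n\<close> but not to \<open>\<xi>\<close>.\<close>
    have "\<epsilon> 0 * adj (\<epsilon> 0) \<in> z" unfolding z_def
      by (rule mult_adj_in_vector_ann[OF V eV]) (auto simp: fe)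
    then have "adj \<xi> * (\<epsilon> 0 * adj (\<epsilon> 0)) = 0"
      unfolding \<open>x = z\<close>[symmetric] unfolding x_def vector_ann_def by blast
    then have "r * adj (\<epsilon> 0) = 0" using \<xi>e[of 0] by (simp add: mult.assoc[symmetric])
    then have "r * (adj (\<epsilon> 0) * \<epsilon> 0) = 0" by (metis mult.assoc mult_zero_left)
    then have "adj r * r = 0" by (simp add: ee rsa)
    then show False using r0 by simp
  qed
  \<comment> \<open>The vectors \<open>\<epsilon> n - 2 \<epsilon> (n + 1)\<close> belong to \<open>x\<close> and the vectors \<open>\<epsilon> n + 4\<^sup>-\<^sup>n \<phi> n\<close> to \<open>y\<close>. What
    annihilates them satisfies \<open>b * \<phi> n = - 2 ^ n (b * \<epsilon> 0)\<close>, which is unbounded unless it vanishes.\<close>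
  have key: "b * \<epsilon> n = 0 \<and> b * \<phi> n = 0"
    if w: "\<And>n. b * (\<epsilon> n - 2 *\<^sub>R \<epsilon> (Suc n)) = 0" and g: "\<And>n. b * (\<epsilon> n + (1/4) ^ n *\<^sub>R \<phi> n) = 0" for b n
  proof -
    have be: "b * \<epsilon> n = (1/2) ^ n *\<^sub>R (b * \<epsilon> 0)" for n
    proof (induction n)
      case (Suc n)
      have "b * \<epsilon> n = 2 *\<^sub>R (b * \<epsilon> (Suc n))" using w[of n] by (simp add: right_diff_distrib)
      then have "b * \<epsilon> (Suc n) = (1/2) *\<^sub>R (b * \<epsilon> n)" by simp
      then show ?case by (simp add: Suc)
    qed simp
    have bf: "b * \<phi> n = - (2 ^ n *\<^sub>R (b * \<epsilon> 0))" for n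
    proof -
      have "(1/4) ^ n *\<^sub>R (b * \<phi> n) = - ((1/2) ^ n *\<^sub>R (b * \<epsilon> 0))"
        using g[of n] be[of n] by (simp add: distrib_left eq_neg_iff_add_eq_0 add.commute)
      then have "4 ^ n *\<^sub>R ((1/4) ^ n *\<^sub>R (b * \<phi> n)) = 4 ^ n *\<^sub>R (- ((1/2) ^ n *\<^sub>R (b * \<epsilon> 0)))"
        by (rule arg_cong)
      then show ?thesis by (simp flip: power_mult_distrib)
    qed
    have "b * \<epsilon> 0 = 0"
    proof (rule ccontr)
      assume "b * \<epsilon> 0 \<noteq> 0"
      then have p: "norm (b * \<epsilon> 0) > 0" by simp
      obtain j where "norm b * K / norm (b * \<epsilon> 0) < 2 ^ j" using real_arch_pow[of 2] by auto
      then have "norm b * K < 2 ^ j * norm (b * \<epsilon> 0)" using p by (simp add: divide_simps)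
      also have "\<dots> = norm (b * \<phi> j)" by (simp add: bf)
      also have "\<dots> \<le> norm b * K" using norm_mult_ineq[of b "\<phi> j"] by (simp add: nf)
      finally show False by simp
    qed
    then show ?thesis using be[of n] bf[of n] by simp
  qed
  have wx: "(\<epsilon> n - 2 *\<^sub>R \<epsilon> (Suc n)) * adj (\<epsilon> n - 2 *\<^sub>R \<epsilon> (Suc n)) \<in> x" for n unfolding x_def
    by (rule mult_adj_in_vector_ann[OF V]) (auto simp: right_diff_distrib fe \<xi>e intro!: diffV scV eV)
  \<comment> \<open>In the pairing with the generator of \<open>y\<close> of the same index, the
    \<open>\<phi>\<close> part and the \<open>\<epsilon>\<close> part contribute opposite multiples
    of \<open>r\<close>.\<close>
  have gy: "(\<epsilon> n + (1/4) ^ n *\<^sub>R \<phi> n) * adj (\<epsilon> n + (1/4) ^ n *\<^sub>R \<phi> n) \<in> y" for n unfolding y_def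
    by (rule mult_adj_in_vector_ann[OF V])
      (auto simp: algebra_simps adj_diff adj_scaleR ee ef fe ff intro!: addV scV eV fV)
  have sup2: "is_sup_in (Plattice V) x y V"
  proof -
    have "V \<subseteq> u" if u: "u \<in> Plattice V" "x \<subseteq> u" "y \<subseteq> u" for u
    proof -
      obtain S where S: "S \<subseteq> pos_in V" and uS: "u = Ann V (Ann V S)"
        using u(1) unfolding Plattice_def by blast
      \<comment> \<open>It suffices that \<open>Ann V S\<close> is trivial, for then its annihilator
        \<open>u\<close> is all of \<open>V\<close>. Such an \<open>a\<close> will turn out to lie
        in \<open>D\<close>, hence in \<open>u\<close>, while annihilating \<open>u\<close>.\<close>
      have "a = 0" if aS: "a \<in> Ann V S" for a
      proof -
        have aV: "a \<in> V" using aS Ann_subset by blast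
        have zero: "adj \<psi> * a = 0 \<and> a * \<psi> = 0" if "\<psi> * adj \<psi> \<in> u" for \<psi>
        proof -
          have "\<psi> * adj \<psi> * a + a * (\<psi> * adj \<psi>) = 0" using that aS unfolding uS Ann_def[of V "Ann V S"] by blast
          then have "a * (adj (adj \<psi>) * adj \<psi>) + (adj (adj \<psi>) * adj \<psi>) * a = 0"
            by (simp add: adj_adj add.commute)
          then show ?thesis unfolding anticommute_adj_mult_iff by (simp add: adj_adj)
        qed
        have zero': "adj a * \<psi> = 0" if "\<psi> * adj \<psi> \<in> u" for \<psi>
        proof -
          have "adj a * \<psi> = adj (adj \<psi> * a)" by (simp add: adj_mult adj_adj)
          then show ?thesis using zero[OF that] by simp
        qed
        have wu: "(\<epsilon> n - 2 *\<^sub>R \<epsilon> (Suc n)) * adj (\<epsilon> n - 2 *\<^sub>R \<epsilon> (Suc n)) \<in> u" for n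
          using wx u(2) by blast
        have gu: "(\<epsilon> n + (1/4) ^ n *\<^sub>R \<phi> n) * adj (\<epsilon> n + (1/4) ^ n *\<^sub>R \<phi> n) \<in> u" for n
          using gy u(3) by blast
        have 1: "a * \<epsilon> n = 0" "a * \<phi> n = 0" for n
          using key[of a n] zero wu gu by blast+
        \<comment> \<open>\<open>key\<close> only concerns multiplication from the left, so the
          other side is reached through the adjoint.\<close>
        have "adj a * \<epsilon> n = 0" "adj a * \<phi> n = 0" for n
          using key[of "adj a" n] zero' wu gu by blast+
        then have 2: "adj (adj a * \<epsilon> n) = 0" "adj (adj a * \<phi> n) = 0" for n by simp_all
        have "a \<in> D" unfolding D_def vector_ann_def
          using 1 2 aV by (auto simp: adj_mult adj_adj)
        \<comment> \<open>Self-adjointness of \<open>D\<close> puts \<open>adj a\<close> into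
          \<open>u\<close>, so \<open>a\<close> anticommutes with its own adjoint, and positivity
          forces \<open>a = 0\<close>.\<close>
        moreover have "adj b \<in> D" if "b \<in> D" for b
        proof -
          have b: "b \<in> V" "\<And>\<tau>. \<tau> \<in> range \<phi> \<union> range \<epsilon> \<Longrightarrow> b * \<tau> = 0 \<and> adj \<tau> * b = 0"
            using that unfolding D_def vector_ann_def by blast+
          have "adj b * \<tau> = 0 \<and> adj \<tau> * adj b = 0" if "\<tau> \<in> range \<phi> \<union> range \<epsilon>" for \<tau>
          proof -
            have "adj (b * \<tau>) = 0" "adj (adj \<tau> * b) = 0" using b(2)[OF that] by simp_all
            then show ?thesis by (simp add: adj_mult adj_adj)
          qed
          then show ?thesis using adjV[OF b(1)] unfolding D_def vector_ann_def by blast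
        qed
        ultimately have "adj a \<in> u" using Dx u(2) by blast
        then have "adj a * a + a * adj a = 0" using aS unfolding uS Ann_def[of V "Ann V S"] by blast
        then have "adj a * a + adj (adj a) * adj a = 0" by (simp add: adj_adj)
        then show ?thesis by (rule sum_adj_mult_eq_0D)
      qed
      then show ?thesis unfolding uS Ann_def[of V "Ann V S"] by fastforce
    qed
    then show ?thesis using L(5) zV unfolding is_sup_in_def emp by blast
  qed
  \<comment> \<open>The two sides of the modular law: \<open>x\<close> joined with \<open>D\<close>
    is \<open>x\<close>, and \<open>V\<close> met with \<open>z\<close> is \<open>z\<close>.\<close>
  have "x = z" by (rule modular[OF L(1,2,3) xz inf1 sup1 sup2 inf2])
  with \<open>x \<noteq> z\<close> show False ..
qed

theorem theorem29:
  assumes "simple_cstar TYPE('a::cstar_algebra)"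
    and "purely_infinite TYPE('a)"
  shows "type_III TYPE('a)"
  unfolding type_III_def purely_nonmodular_def
proof (intro ballI impI, rule ccontr)
  fix V :: "'a set"
  assume V: "V \<in> Plattice UNIV" and "modular_annihilator V" and "V \<noteq> {0}"
  then obtain p where "p \<in> V" "infinite_projection p"
    using assms(2) Plattice_hereditary(1)[OF V] unfolding purely_infinite_def by blast
  then obtain e :: "nat \<Rightarrow> 'a" and r where e: "\<And>n. e n \<in> V" "r \<noteq> 0"
    "\<And>m n. adj (e m) * e n = (if m = n then r else 0)"
    using infinite_projection_shift[OF V] by metis
  \<comment> \<open>Parity makes the even and odd subsequences mutually orthogonal.\<close>
  have "2 * m \<noteq> Suc (2 * n)" for m n :: nat by presburger
  then have "\<not> modular_lattice (Plattice V)"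
    using Plattice_hereditary(2)[OF V] e
    by (intro not_modular_if_orthonormal_sequences[of V "\<lambda>n. e (2 * n)" "\<lambda>n. e (Suc (2 * n))" r]) auto
  then show False using \<open>modular_annihilator V\<close> unfolding modular_annihilator_def by blast
qed

end
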